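(* Let $N=\{1,\dots,n\}$ be a set of agents with $n\ge 2$ and let $X$ be a finite set of alternatives with $|X|\ge 3$. Let $\mathcal{P}$ be the set of all strict preferences over $X$. Let $\mathcal{S}$ be the set of all functions $f:\mathcal{P}^n\to X$ that are unanimous and strategy-proof, and let $\mathcal{D}$ be the set of all functions $f:\mathcal{P}^n\to X$ that are dictatorial. Then $\mathcal{S}=\mathcal{D}$.
   Context: A strict preference $P_i$ over $X$ is a strict linear order on $X$ ($xP_iy$ means $x$ is strictly preferred to $y$); its top $t(P_i)$ is its best alternative. A profile is $P=(P_1,\dots,P_n)\in\mathcal{P}^n$; $(P_i',P_{-i})$ denotes the profile obtained from $P$ by replacing $P_i$ with $P_i'$. A (social choice) rule is a function $f:\mathcal{P}^n\to X$. - $f$ is unanimous if $f(P)=x$ whenever $t(P_i)=x$ for each $i\in N$. - Agent $i$ manipulates $f$ at $P$ via $P_i'\in\mathcal{P}$ if $f(P_i',P_{-i})\,P_i\,f(P)$. $f$ is strategy-proof if there are no agent $i$, profile $P$ and preference $P_i'$ such that $i$ manipulates $f$ at $P$ via $P_i'$. - $f$ is dictatorial if there is $i\in N$ such that $f(P)=t(P_i)$ for each $P\in\mathcal{P}^n$. *)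

theory Defs
  imports Main "HOL-Library.FuncSet"
begin

text \<open>
  \<open>(x, y) \<in> R\<close> means that \<open>x\<close> is strictly preferred to \<open>y\<close>. The inclusion in \<open>X \<times> X\<close> is needed
  because \<^const>\<open>strict_linear_order_on\<close> does not confine the relation to its carrier.
\<close>

definition strict_prefs :: "'a set \<Rightarrow> 'a rel set" where
  "strict_prefs X = {R. R \<subseteq> X \<times> X \<and> strict_linear_order_on X R}"

definition top_alt :: "'a set \<Rightarrow> 'a rel \<Rightarrow> 'a" where
  "top_alt X R = (THE x. x \<in> X \<and> (\<forall>y\<in>X. y \<noteq> x \<longrightarrow> (x, y) \<in> R))"

text \<open>
  Profiles and rules are extensional functions (\<open>undefined\<close> outside their domain), so that
  equality of rules is equality of functions from \<open>profiles n X\<close> to \<open>X\<close>.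
\<close>

definition profiles :: "nat \<Rightarrow> 'a set \<Rightarrow> (nat \<Rightarrow> 'a rel) set" where
  "profiles n X = {1..n} \<rightarrow>\<^sub>E strict_prefs X"

definition rules :: "nat \<Rightarrow> 'a set \<Rightarrow> ((nat \<Rightarrow> 'a rel) \<Rightarrow> 'a) set" where
  "rules n X = profiles n X \<rightarrow>\<^sub>E X"

definition unanimous :: "nat \<Rightarrow> 'a set \<Rightarrow> ((nat \<Rightarrow> 'a rel) \<Rightarrow> 'a) \<Rightarrow> bool" where
  "unanimous n X f \<longleftrightarrow>
     (\<forall>P\<in>profiles n X. \<forall>x\<in>X. (\<forall>i\<in>{1..n}. top_alt X (P i) = x) \<longrightarrow> f P = x)"

definition manipulates ::
  "((nat \<Rightarrow> 'a rel) \<Rightarrow> 'a) \<Rightarrow> nat \<Rightarrow> (nat \<Rightarrow> 'a rel) \<Rightarrow> 'a rel \<Rightarrow> bool" where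
  "manipulates f i P R \<longleftrightarrow> (f (P(i := R)), f P) \<in> P i"

definition strategy_proof :: "nat \<Rightarrow> 'a set \<Rightarrow> ((nat \<Rightarrow> 'a rel) \<Rightarrow> 'a) \<Rightarrow> bool" where
  "strategy_proof n X f \<longleftrightarrow>
     \<not> (\<exists>i\<in>{1..n}. \<exists>P\<in>profiles n X. \<exists>R\<in>strict_prefs X. manipulates f i P R)"

definition dictatorial :: "nat \<Rightarrow> 'a set \<Rightarrow> ((nat \<Rightarrow> 'a rel) \<Rightarrow> 'a) \<Rightarrow> bool" where
  "dictatorial n X f \<longleftrightarrow> (\<exists>i\<in>{1..n}. \<forall>P\<in>profiles n X. f P = top_alt X (P i))"

end

theory Submission
  imports Defs
begin

text \<open>
  Strategy-proofness makes \<open>f\<close> Maskin monotonic. Say that a coalition \<open>G\<close> blocks \<open>y\<close> by \<open>x\<close> if \<open>y\<close>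
  is never chosen when all of \<open>G\<close> prefer \<open>x\<close> to \<open>y\<close>. By monotonicity, a single profile at which \<open>x\<close>
  is chosen although everybody outside \<open>G\<close> prefers \<open>y\<close> to \<open>x\<close> suffices for this. A Condorcet
  profile then shows that if \<open>A \<union> B\<close> blocks \<open>y\<close> by \<open>x\<close>, then \<open>A\<close> blocks \<open>z\<close> by \<open>x\<close> or \<open>B\<close> blocks
  \<open>y\<close> by \<open>z\<close>. Taking \<open>A\<close> or \<open>B\<close> empty, blocking for one pair spreads to all pairs; taking both
  nonempty, the grand coalition shrinks to a single blocking agent, who is a dictator.
\<close>

section \<open>Strict preferences\<close>

lemma strict_prefs_carrier:
  assumes "R \<in> strict_prefs X" "(a, b) \<in> R"
  shows "a \<in> X" "b \<in> X"
  using assms by (auto simp: strict_prefs_def)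

lemma strict_prefs_irrefl:
  assumes "R \<in> strict_prefs X"
  shows "(a, a) \<notin> R"
  using assms by (auto simp: strict_prefs_def strict_linear_order_on_def irrefl_def)

lemma strict_prefs_asym:
  assumes "R \<in> strict_prefs X" "(a, b) \<in> R"
  shows "(b, a) \<notin> R"
  using assms strict_prefs_irrefl[OF assms(1)]
  by (auto simp: strict_prefs_def strict_linear_order_on_def dest: transD)

lemma strict_prefs_total:
  assumes "R \<in> strict_prefs X" "a \<in> X" "b \<in> X" "a \<noteq> b"
  shows "(a, b) \<in> R \<or> (b, a) \<in> R"
  using assms by (auto simp: strict_prefs_def strict_linear_order_on_def total_on_def)

text \<open>The well-ordering theorem supplies a linear order, whose strict part qualifies. It
  serves as the arbitrary base from which special profiles are built.\<close>

lemma strict_prefs_nonempty: "strict_prefs X \<noteq> {}"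
proof -
  obtain r where r: "well_order_on X r"
    using well_order_on by blast
  then have "linear_order_on X r"
    by (simp add: well_order_on_def)
  moreover from this have "r - Id \<subseteq> X \<times> X"
    by (auto simp: order_on_defs)
  ultimately have "r - Id \<in> strict_prefs X"
    by (simp add: strict_prefs_def strict_linear_order_on_diff_Id)
  then show ?thesis by blast
qed

lemma top_alt_eqI:
  assumes "R \<in> strict_prefs X" "x \<in> X" "\<And>y. y \<in> X \<Longrightarrow> y \<noteq> x \<Longrightarrow> (x, y) \<in> R"
  shows "top_alt X R = x"
  unfolding top_alt_def
proof (rule the_equality)
  show "x \<in> X \<and> (\<forall>y\<in>X. y \<noteq> x \<longrightarrow> (x, y) \<in> R)" using assms by blast
  show "y = x" if "y \<in> X \<and> (\<forall>z\<in>X. z \<noteq> y \<longrightarrow> (y, z) \<in> R)" for y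
    using that assms strict_prefs_asym[OF assms(1)] by metis
qed

lemma top_alt:
  assumes "finite X" "X \<noteq> {}" "R \<in> strict_prefs X"
  shows "top_alt X R \<in> X" "\<And>y. y \<in> X \<Longrightarrow> y \<noteq> top_alt X R \<Longrightarrow> (top_alt X R, y) \<in> R"
proof -
  have "finite R"
    using assms finite_subset[of R "X \<times> X"] by (auto simp: strict_prefs_def)
  moreover have "acyclic R"
    using assms(3) by (auto simp: strict_prefs_def strict_linear_order_on_def
        acyclic_irrefl trancl_id)
  \<comment> \<open>Pairs list the better alternative first, so a minimal element is one to which
    nothing is preferred.\<close>
  ultimately have "wf R" by (rule finite_acyclic_wf)
  with assms(2) obtain x where x: "x \<in> X" "\<And>y. (y, x) \<in> R \<Longrightarrow> y \<notin> X"
    by (metis ex_in_conv wf_eq_minimal)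
  then have max: "(x, y) \<in> R" if "y \<in> X" "y \<noteq> x" for y
    using that strict_prefs_total[OF assms(3)] by blast
  then have "top_alt X R = x"
    using assms(3) x(1) by (intro top_alt_eqI)
  with x max show "top_alt X R \<in> X"
    "\<And>y. y \<in> X \<Longrightarrow> y \<noteq> top_alt X R \<Longrightarrow> (top_alt X R, y) \<in> R" by auto
qed

text \<open>Nesting these lifts prescribes the first few places of a preference, the outermost lift
  giving the first place.\<close>

definition lift_top :: "'a set \<Rightarrow> 'a \<Rightarrow> 'a rel \<Rightarrow> 'a rel" where
  "lift_top X x R = {x} \<times> (X - {x}) \<union> {(a, b) \<in> R. a \<noteq> x \<and> b \<noteq> x}"

lemma in_lift_top_iff:
  "(a, b) \<in> lift_top X x R \<longleftrightarrow> b \<noteq> x \<and> (if a = x then b \<in> X else (a, b) \<in> R)"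
  by (auto simp: lift_top_def)

lemma lift_top_strict_prefs:
  assumes "R \<in> strict_prefs X" "x \<in> X"
  shows "lift_top X x R \<in> strict_prefs X"
proof -
  have "trans (lift_top X x R)"
    using assms by (auto simp: strict_prefs_def strict_linear_order_on_def in_lift_top_iff
        split: if_splits intro!: transI dest: transD)
  moreover have "irrefl (lift_top X x R)"
    using strict_prefs_irrefl[OF assms(1)] by (auto simp: irrefl_def in_lift_top_iff)
  moreover have "total_on X (lift_top X x R)"
    using strict_prefs_total[OF assms(1)] by (auto simp: total_on_def in_lift_top_iff)
  moreover have "lift_top X x R \<subseteq> X \<times> X"
    using assms by (auto simp: strict_prefs_def in_lift_top_iff lift_top_def)
  ultimately show ?thesis
    by (simp add: strict_prefs_def strict_linear_order_on_def)
qed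

lemma top_alt_lift_top:
  assumes "R \<in> strict_prefs X" "x \<in> X"
  shows "top_alt X (lift_top X x R) = x"
  using assms by (intro top_alt_eqI lift_top_strict_prefs) (auto simp: in_lift_top_iff)

lemma profilesD:
  assumes "P \<in> profiles n X" "i \<in> {1..n}"
  shows "P i \<in> strict_prefs X"
  using assms by (auto simp: profiles_def)

lemma restrict_profiles:
  assumes "\<And>i. i \<in> {1..n} \<Longrightarrow> Q i \<in> strict_prefs X"
  shows "restrict Q {1..n} \<in> profiles n X"
  using assms by (auto simp: profiles_def)

lemma profile_upd:
  assumes "P \<in> profiles n X" "i \<in> {1..n}" "R \<in> strict_prefs X"
  shows "P(i := R) \<in> profiles n X"
  using assms by (auto simp: profiles_def PiE_def extensional_def)

lemma ex_third_element:
  assumes "3 \<le> card X"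
  shows "\<exists>z\<in>X. z \<noteq> x \<and> z \<noteq> y"
proof -
  have "\<not> X \<subseteq> {x, y}"
    using assms card_mono[of "{x, y}" X] card_insert_le_m1[of 2 "{y}" x] by fastforce
  then show ?thesis by blast
qed

section \<open>Blocking coalitions\<close>

locale sp_rule =
  fixes n :: nat and X :: "'a set" and f :: "(nat \<Rightarrow> 'a rel) \<Rightarrow> 'a"
  assumes rule: "f \<in> rules n X"
    and unan: "unanimous n X f"
    and sp: "strategy_proof n X f"
begin

section \<open>Maskin monotonicity\<close>

lemma rule_in: "P \<in> profiles n X \<Longrightarrow> f P \<in> X"
  using rule by (auto simp: rules_def)

lemma not_manipulable:
  assumes "P \<in> profiles n X" "i \<in> {1..n}" "R \<in> strict_prefs X"
  shows "(f (P(i := R)), f P) \<notin> P i"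
  using sp assms by (auto simp: strategy_proof_def manipulates_def)

text \<open>If the outcome changed, truthfulness at \<open>P\<close> would make the old outcome
  better under \<open>P i\<close>, hence under \<open>R\<close> by \<open>mono\<close>. An agent
  with preference \<open>R\<close> would then gain by reporting \<open>P i\<close>.\<close>

lemma monotone_upd:
  assumes P: "P \<in> profiles n X" and i: "i \<in> {1..n}" and R: "R \<in> strict_prefs X"
    and mono: "\<And>y. (f P, y) \<in> P i \<Longrightarrow> (f P, y) \<in> R"
  shows "f (P(i := R)) = f P"
proof (rule ccontr)
  let ?Q = "P(i := R)"
  assume neq: "f ?Q \<noteq> f P"
  have Q: "?Q \<in> profiles n X" using P i R by (rule profile_upd)
  have "(f P, f ?Q) \<in> P i"
    using neq not_manipulable[OF P i R] strict_prefs_total[OF profilesD[OF P i]]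
      rule_in[OF P] rule_in[OF Q] by metis
  then have "(f (?Q(i := P i)), f ?Q) \<in> ?Q i"
    using mono by simp
  then show False
    using not_manipulable[OF Q i profilesD[OF P i]] by blast
qed

lemma monotone:
  assumes P: "P \<in> profiles n X" and Q: "Q \<in> profiles n X"
    and mono: "\<And>i y. i \<in> {1..n} \<Longrightarrow> (f P, y) \<in> P i \<Longrightarrow> (f P, y) \<in> Q i"
  shows "f Q = f P"
proof -
  \<comment> \<open>Agents switch from \<open>P\<close> to \<open>Q\<close> one at a time; those in
    \<open>S\<close> have already switched.\<close>
  have "override_on P Q S \<in> profiles n X \<and> f (override_on P Q S) = f P"
    if "finite S" "S \<subseteq> {1..n}" for S
    using that
  proof (induction S rule: finite_induct)
    case empty
    then show ?case using P by simp
  next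
    case (insert i S)
    let ?H = "override_on P Q S"
    have H: "?H \<in> profiles n X" "f ?H = f P" and i: "i \<in> {1..n}"
      using insert by auto
    have "f (?H(i := Q i)) = f ?H"
      using H insert.hyps mono[OF i] by (intro monotone_upd i profilesD[OF Q]) auto
    then show ?case
      using profile_upd[OF H(1) i profilesD[OF Q i]] H(2)
      by (simp only: override_on_insert simp_thms)
  qed
  moreover have "override_on P Q {1..n} = Q"
    using P Q by (auto simp: fun_eq_iff override_on_def profiles_def PiE_def extensional_def)
  ultimately show ?thesis
    by (metis finite_atLeastAtMost subset_refl)
qed

section \<open>Blocking and its one-profile criterion\<close>

definition blocks :: "nat set \<Rightarrow> 'a \<Rightarrow> 'a \<Rightarrow> bool" where
  "blocks G x y \<longleftrightarrow> (\<forall>P\<in>profiles n X. (\<forall>i\<in>G. (x, y) \<in> P i) \<longrightarrow> f P \<noteq> y)"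

lemma blocksD:
  assumes "blocks G x y" "P \<in> profiles n X" "\<And>i. i \<in> G \<Longrightarrow> (x, y) \<in> P i"
  shows "f P \<noteq> y"
  using assms by (auto simp: blocks_def)

text \<open>If \<open>y\<close> were chosen, it would stay chosen after everybody lifts
  \<open>x\<close> to the top, since \<open>x\<close> already lay above \<open>y\<close>. Unanimity
  forces \<open>x\<close> there.\<close>

lemma all_block:
  assumes "x \<in> X" "x \<noteq> y"
  shows "blocks {1..n} x y"
  unfolding blocks_def
proof (intro ballI impI notI)
  fix P assume P: "P \<in> profiles n X" and pref: "\<forall>i\<in>{1..n}. (x, y) \<in> P i" and y: "f P = y"
  let ?Q = "\<lambda>i\<in>{1..n}. lift_top X x (P i)"
  have Q: "?Q \<in> profiles n X"
    using P assms(1) by (intro restrict_profiles lift_top_strict_prefs profilesD)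
  have "f ?Q = f P"
    using P Q pref y strict_prefs_asym[OF profilesD[OF P]] assms(2)
    by (intro monotone) (auto simp: in_lift_top_iff)
  moreover have "\<forall>i\<in>{1..n}. top_alt X (?Q i) = x"
    using top_alt_lift_top[OF profilesD[OF P] assms(1)] by simp
  then have "f ?Q = x"
    using unan Q assms(1) unfolding unanimous_def by blast
  ultimately show False using y assms(2) by simp
qed

text \<open>The empty coalition imposes no condition, so a profile with \<open>y\<close> on top
  everywhere refutes it. This discards one alternative when a coalition is split with an empty
  part.\<close>

lemma not_empty_blocks:
  assumes "y \<in> X"
  shows "\<not> blocks {} x y"
proof -
  obtain R where "R \<in> strict_prefs X" using strict_prefs_nonempty by blast
  then have R: "lift_top X y R \<in> strict_prefs X" "top_alt X (lift_top X y R) = y"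
    using assms by (simp_all add: lift_top_strict_prefs top_alt_lift_top)
  let ?P = "\<lambda>i\<in>{1..n}. lift_top X y R"
  have P: "?P \<in> profiles n X" using R by (intro restrict_profiles)
  moreover have "\<forall>i\<in>{1..n}. top_alt X (?P i) = y" using R by simp
  ultimately have "f ?P = y"
    using unan assms unfolding unanimous_def by blast
  with P show ?thesis by (auto simp: blocks_def)
qed

lemma blocksI:
  assumes P: "P \<in> profiles n X" and fP: "f P = x" and neq: "x \<noteq> y" and y: "y \<in> X"
    and against: "\<And>i. i \<in> {1..n} - G \<Longrightarrow> (y, x) \<in> P i"
  shows "blocks G x y"
  unfolding blocks_def
proof (intro ballI impI notI)
  fix P' assume P': "P' \<in> profiles n X" and pref: "\<forall>i\<in>G. (x, y) \<in> P' i" and fP': "f P' = y"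
  have x: "x \<in> X" using rule_in[OF P] fP by simp
  \<comment> \<open>In \<open>?Q\<close> the top two are \<open>x\<close>, \<open>y\<close> within
    \<open>G\<close> and \<open>y\<close>, \<open>x\<close> outside. Monotonicity applies from
    \<open>P\<close> and from \<open>P'\<close>, so both \<open>x\<close> and \<open>y\<close> would
    be chosen.\<close>
  let ?Q = "\<lambda>i\<in>{1..n}. if i \<in> G then lift_top X x (lift_top X y (P i))
    else lift_top X y (lift_top X x (P i))"
  have Q: "?Q \<in> profiles n X"
    using x y profilesD[OF P] by (intro restrict_profiles) (simp add: lift_top_strict_prefs)
  have "f ?Q = f P"
  proof (rule monotone[OF P Q])
    fix i b assume i: "i \<in> {1..n}" and b: "(f P, b) \<in> P i"
    have Pi: "P i \<in> strict_prefs X" using P i by (rule profilesD)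
    have "b \<in> X" "b \<noteq> x"
      using b fP strict_prefs_carrier[OF Pi] strict_prefs_irrefl[OF Pi] by auto
    moreover have "b \<noteq> y" if "i \<notin> G"
      using that b fP against[of i] i strict_prefs_asym[OF Pi] by blast
    ultimately show "(f P, b) \<in> ?Q i"
      using i fP neq by (auto simp: in_lift_top_iff)
  qed
  moreover have "f ?Q = f P'"
  proof (rule monotone[OF P' Q])
    fix i b assume i: "i \<in> {1..n}" and b: "(f P', b) \<in> P' i"
    have Pi: "P' i \<in> strict_prefs X" using P' i by (rule profilesD)
    have "b \<in> X" "b \<noteq> y"
      using b fP' strict_prefs_carrier[OF Pi] strict_prefs_irrefl[OF Pi] by auto
    moreover have "b \<noteq> x" if "i \<in> G"
      using that b fP' pref strict_prefs_asym[OF Pi] by blast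
    ultimately show "(f P', b) \<in> ?Q i"
      using i fP' neq by (auto simp: in_lift_top_iff)
  qed
  ultimately show False using fP fP' neq by simp
qed

section \<open>From the grand coalition to a dictator\<close>

lemma blocks_split:
  assumes bl: "blocks (A \<union> B) x y" and sub: "A \<union> B \<subseteq> {1..n}" and disj: "A \<inter> B = {}"
    and X: "x \<in> X" "y \<in> X" "z \<in> X" and neq: "x \<noteq> y" "y \<noteq> z" "z \<noteq> x"
  shows "blocks A x z \<or> blocks B z y"
proof -
  obtain R where R: "R \<in> strict_prefs X" using strict_prefs_nonempty by blast
  define chain where
    "chain a b c = lift_top X a (lift_top X b (lift_top X c R))" for a b c
  \<comment> \<open>A Condorcet cycle: \<open>A\<close> ranks x y z, \<open>B\<close> ranks z x y,
    all others y z x. Below the third place the ranking is immaterial.\<close>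
  define P where
    "P = (\<lambda>i\<in>{1..n}. if i \<in> A then chain x y z else if i \<in> B then chain z x y else chain y z x)"
  have P: "P \<in> profiles n X"
    unfolding P_def chain_def
    using R X by (intro restrict_profiles) (simp add: lift_top_strict_prefs)
  have "f P \<noteq> y"
  proof (rule blocksD[OF bl P])
    show "(x, y) \<in> P i" if "i \<in> A \<union> B" for i
      using that sub X neq by (auto simp: P_def chain_def in_lift_top_iff)
  qed
  \<comment> \<open>Everybody ranks \<open>x\<close> above any fourth alternative, so the grand
    coalition blocks it.\<close>
  moreover have "f P = x \<or> f P = y \<or> f P = z"
  proof (rule ccontr)
    assume other: "\<not> (f P = x \<or> f P = y \<or> f P = z)"
    then have "(x, f P) \<in> P i" if "i \<in> {1..n}" for i
      using that rule_in[OF P] by (auto simp: P_def chain_def in_lift_top_iff)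
    then show False
      using blocksD[OF all_block P] X(1) other by metis
  qed
  \<comment> \<open>Outside \<open>A\<close> everybody prefers \<open>z\<close> to \<open>x\<close>;
    outside \<open>B\<close> everybody prefers \<open>y\<close> to \<open>z\<close>. Either outcome
    thus meets the one-profile criterion.\<close>
  ultimately consider "f P = x" | "f P = z" by blast
  then show ?thesis
  proof cases
    case 1
    then have "blocks A x z"
      using P neq X by (intro blocksI[of P]) (auto simp: P_def chain_def in_lift_top_iff)
    then show ?thesis ..
  next
    case 2
    then have "blocks B z y"
      using P neq X by (intro blocksI[of P]) (auto simp: P_def chain_def in_lift_top_iff)
    then show ?thesis ..
  qed
qed

lemma blocks_all_pairs:
  assumes bl: "blocks G x y" and G: "G \<subseteq> {1..n}" and card: "3 \<le> card X"
    and X: "x \<in> X" "y \<in> X" "a \<in> X" "b \<in> X" and neq: "x \<noteq> y" "a \<noteq> b"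
  shows "blocks G a b"
proof -
  have right: "blocks G u w"
    if "blocks G u v" "u \<in> X" "v \<in> X" "w \<in> X" "u \<noteq> v" "w \<noteq> u" for u v w
    using that blocks_split[of G "{}" u v w] not_empty_blocks G by (cases "w = v") auto
  have left: "blocks G w v"
    if "blocks G u v" "u \<in> X" "v \<in> X" "w \<in> X" "u \<noteq> v" "w \<noteq> v" for u v w
    using that blocks_split[of "{}" G u v w] not_empty_blocks G by (cases "w = u") auto
  \<comment> \<open>The route is (x, y), (x, c), (a, c), (a, b). Here \<open>c\<close> may equal
    \<open>y\<close> or \<open>b\<close>, and \<open>a\<close> may equal \<open>x\<close>.\<close>
  obtain c where c: "c \<in> X" "c \<noteq> x" "c \<noteq> a"
    using ex_third_element[OF card] by blast
  have "blocks G x c" using right bl X neq c by metis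
  then have "blocks G a c" using left X c by metis
  then show ?thesis using right X neq c by metis
qed

text \<open>Splitting off one agent through a third alternative either makes that agent block one
  pair, hence all, or leaves the rest blocking a different pair. The induction therefore varies
  \<open>x\<close> and \<open>y\<close>.\<close>

lemma blocking_agent:
  assumes "finite G" "G \<subseteq> {1..n}" "3 \<le> card X"
    and "x \<in> X" "y \<in> X" "x \<noteq> y" "blocks G x y"
  shows "\<exists>i\<in>G. \<forall>a\<in>X. \<forall>b\<in>X. a \<noteq> b \<longrightarrow> blocks {i} a b"
  using assms
proof (induction G arbitrary: x y rule: finite_induct)
  case empty
  then show ?case using not_empty_blocks by blast
next
  case (insert i G)
  obtain z where z: "z \<in> X" "z \<noteq> x" "z \<noteq> y"
    using ex_third_element[OF insert.prems(2)] by blast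
  then have "blocks {i} x z \<or> blocks G z y"
    using insert.prems insert.hyps by (intro blocks_split) auto
  then show ?case
  proof
    assume "blocks {i} x z"
    then show ?thesis
      using blocks_all_pairs[of "{i}" x z] insert.prems z by auto
  next
    assume "blocks G z y"
    then show ?thesis
      using insert.IH[of z y] insert.prems z by auto
  qed
qed

lemma dictatorial:
  assumes card: "3 \<le> card X"
  shows "dictatorial n X f"
proof -
  have fin: "finite X" "X \<noteq> {}" using card by (auto intro: card_ge_0_finite)
  obtain x where x: "x \<in> X" using fin by blast
  obtain y where y: "y \<in> X" "x \<noteq> y"
    using ex_third_element[OF card, of x x] by blast
  obtain i where i: "i \<in> {1..n}"
    and bl: "\<And>a b. a \<in> X \<Longrightarrow> b \<in> X \<Longrightarrow> a \<noteq> b \<Longrightarrow> blocks {i} a b"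
    using blocking_agent[OF _ _ card x y all_block[OF x y(2)]] by auto
  have "f P = top_alt X (P i)" if P: "P \<in> profiles n X" for P
  proof (rule ccontr)
    note top = top_alt[OF fin profilesD[OF P i]]
    assume neq: "f P \<noteq> top_alt X (P i)"
    \<comment> \<open>Agent \<open>i\<close> prefers the own top to any other outcome and therefore
      blocks that outcome.\<close>
    then have "blocks {i} (top_alt X (P i)) (f P)"
      using bl[OF top(1) rule_in[OF P]] by metis
    then show False
      using blocksD[of "{i}" _ "f P" P] P top(2)[OF rule_in[OF P] neq] by blast
  qed
  with i show ?thesis by (auto simp: dictatorial_def)
qed

end

section \<open>Dictatorial rules\<close>

lemma dictatorial_imp_unanimous:
  assumes "dictatorial n X f"
  shows "unanimous n X f"
  using assms by (auto simp: dictatorial_def unanimous_def)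

text \<open>The dictator already obtains the best alternative, and a change by anyone else leaves
  the outcome as it was, which is no strict gain.\<close>

lemma dictatorial_imp_strategy_proof:
  assumes fin: "finite X" "X \<noteq> {}" and "dictatorial n X f"
  shows "strategy_proof n X f"
proof -
  obtain d where d: "d \<in> {1..n}" "\<And>P. P \<in> profiles n X \<Longrightarrow> f P = top_alt X (P d)"
    using assms(3) by (auto simp: dictatorial_def)
  have "(f (P(i := R)), f P) \<notin> P i"
    if i: "i \<in> {1..n}" and P: "P \<in> profiles n X" and R: "R \<in> strict_prefs X" for i P R
  proof -
    note Pi = profilesD[OF P i]
    have "P(i := R) \<in> profiles n X"
      using P i R by (rule profile_upd)
    then have f: "f (P(i := R)) = top_alt X ((P(i := R)) d)" "f P = top_alt X (P d)"
      using d P by blast+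
    show ?thesis
    proof (cases "i = d")
      case True
      then show ?thesis
        using f top_alt(1)[OF fin R] top_alt(2)[OF fin Pi] strict_prefs_asym[OF Pi]
          strict_prefs_irrefl[OF Pi] by (metis fun_upd_same)
    next
      case False
      then show ?thesis using f strict_prefs_irrefl[OF Pi] by simp
    qed
  qed
  then show ?thesis by (auto simp: strategy_proof_def manipulates_def)
qed

theorem theorem1:
  fixes n :: nat and X :: "'a set"
  assumes "n \<ge> 2" and "finite X" and "card X \<ge> 3"
  shows "{f \<in> rules n X. unanimous n X f \<and> strategy_proof n X f} =
         {f \<in> rules n X. dictatorial n X f}"
proof -
  have "X \<noteq> {}" using assms(3) by auto
  then show ?thesis
    using sp_rule.dictatorial[OF sp_rule.intro] assms
      dictatorial_imp_unanimous dictatorial_imp_strategy_proof by blast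
qed

end
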